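(* Let $n>1$ be an integer with $n-1=\prod_{i=1}^k p_i^{s_i}$, where $p_1,\dots,p_k$ are distinct primes and $s_i\ge 1$. Let $m=\prod_{i=1}^k p_i^{t_i}$ with integers $0\le t_i\le s_i$, and suppose that $n$ has the property that if $m\mid\varphi(n)$ then $n$ is prime. If for each $i$ with $t_i\ge 1$ (i.e. each prime $p_i$ dividing $m$) there exists an integer $b_i$ such that $b_i^{\,n-1}\equiv 1\pmod n$ and $b_i^{\,(n-1)/p_i^{\,s_i-t_i+1}}\not\equiv 1\pmod n$, then $n$ is prime.
   Context: $\varphi$ denotes Euler's totient function. *)

theory Defs
  imports "HOL-Number_Theory.Number_Theory"
begin

end

theory Submission
  imports Defs
begin

text \<open>Let \<open>p\<close> be one of the primes dividing \<open>m\<close>, with exponents \<open>s\<close> and \<open>t\<close>, and write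
  \<open>n - 1 = p ^ s * q\<close>. The order \<open>d\<close> of \<open>b\<close> modulo \<open>n\<close> divides \<open>p ^ s * q\<close> but not
  \<open>p ^ (t - 1) * q\<close>, which forces \<open>p ^ t dvd d\<close>; and \<open>d\<close> divides \<open>totient n\<close>. As the prime powers
  are pairwise coprime, \<open>m dvd totient n\<close>.\<close>

text \<open>Split \<open>d = p ^ v * e\<close> with \<open>e\<close> prime to \<open>p\<close>. Then
  \<open>e\<close> divides \<open>q\<close>, so \<open>v \<le> r\<close> would make \<open>d\<close>
  divide \<open>p ^ r * q\<close>.\<close>

lemma prime_power_dvd_of_dvd_not_dvd:
  fixes p q d :: nat
  assumes "prime p" "d dvd p ^ s * q" "\<not> d dvd p ^ r * q"
  shows "p ^ Suc r dvd d"
proof -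
  have "d \<noteq> 0"
  proof
    assume "d = 0"
    then have "q = 0" using assms(1,2) by auto
    then show False using assms(3) by simp
  qed
  then obtain v e where e: "d = p ^ v * e" "\<not> p dvd e"
    using multiplicity_decompose'[of d p] not_prime_unit assms(1) by blast
  then have "e dvd d" by simp
  then have "e dvd p ^ s * q" using assms(2) by (rule dvd_trans)
  moreover have "coprime e (p ^ s)"
    using prime_imp_coprime[OF assms(1) e(2)] by (simp add: coprime_commute)
  ultimately have "e dvd q" by (simp add: coprime_dvd_mult_right_iff)
  have "Suc r \<le> v"
  proof (rule ccontr)
    assume "\<not> Suc r \<le> v"
    then have "p ^ v dvd p ^ r" by (simp add: le_imp_power_dvd)
    then have "d dvd p ^ r * q" unfolding e(1) using \<open>e dvd q\<close> by (rule mult_dvd_mono)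
    then show False using assms(3) by contradiction
  qed
  then show ?thesis unfolding e(1) by (intro dvd_mult2 le_imp_power_dvd)
qed

lemma prime_power_dvd_totient:
  fixes p q n :: nat and b :: int
  assumes "prime p" "n > 1" "q > 0"
    and "[b ^ (p ^ s * q) = 1] (mod int n)" "[b ^ (p ^ r * q) \<noteq> 1] (mod int n)"
  shows "p ^ Suc r dvd totient n"
proof -
  \<comment> \<open>\<open>ord\<close> takes natural numbers, so the integer \<open>b\<close> is
    replaced by its least nonnegative residue.\<close>
  define a where "a = nat (b mod int n)"
  have "[int a = b] (mod int n)"
    using assms(2) by (simp add: a_def)
  then have "[int (a ^ j) = b ^ j] (mod int n)" for j
    by (simp add: cong_pow)
  then have "[b ^ j = 1] (mod int n) \<longleftrightarrow> [int (a ^ j) = int 1] (mod int n)" for j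
    by (simp add: cong_def)
  then have *: "[b ^ j = 1] (mod int n) \<longleftrightarrow> ord n a dvd j" for j
    by (simp only: cong_int_iff ord_divides)
  \<comment> \<open>\<open>ord n a\<close> is 0 when \<open>a\<close> is not coprime to
    \<open>n\<close>, and 0 divides no positive exponent; so the first congruence forces
    coprimality.\<close>
  have "p ^ s * q > 0" using assms(1,3) by (simp add: prime_gt_0_nat)
  then have "coprime n a"
    using ord_eq_0[of n a] *[of "p ^ s * q"] assms(4) by auto
  then have "ord n a dvd totient n" by (rule order_divides_totient)
  moreover have "p ^ Suc r dvd ord n a"
    using prime_power_dvd_of_dvd_not_dvd assms(1,4,5) * by blast
  ultimately show ?thesis by (rule dvd_trans[rotated])
qed

theorem theorem4p3:
  fixes n m k :: nat and p s t :: "nat \<Rightarrow> nat"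
  assumes "n > 1"
    and "n - 1 = (\<Prod>i=1..k. p i ^ s i)"
    and "\<And>i. i \<in> {1..k} \<Longrightarrow> prime (p i)"
    and "inj_on p {1..k}"
    and "\<And>i. i \<in> {1..k} \<Longrightarrow> s i \<ge> 1"
    and "m = (\<Prod>i=1..k. p i ^ t i)"
    and "\<And>i. i \<in> {1..k} \<Longrightarrow> t i \<le> s i"
    and "m dvd totient n \<longrightarrow> prime n"
    and "\<And>i. i \<in> {1..k} \<Longrightarrow> t i \<ge> 1 \<Longrightarrow>
           \<exists>b::int. [b ^ (n - 1) = 1] (mod int n) \<and>
                    [b ^ ((n - 1) div p i ^ (s i - t i + 1)) \<noteq> 1] (mod int n)"
  shows "prime n"
proof -
  have dvd: "p i ^ t i dvd totient n" if i: "i \<in> {1..k}" for i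
  proof (cases "t i")
    case (Suc r)
    define q where "q = (\<Prod>j\<in>{1..k} - {i}. p j ^ s j)"
    have n1: "n - 1 = p i ^ s i * q"
      using i assms(2) by (simp add: q_def prod.remove)
    have "p i > 0" using assms(3) i by (simp add: prime_gt_0_nat)
    have "q > 0" using n1 assms(1) by (metis mult_is_0 not_gr_zero zero_less_diff)
    \<comment> \<open>With \<open>t i = Suc r\<close>, dividing \<open>n - 1\<close> by
      \<open>p i ^ (s i - t i + 1)\<close> leaves exactly \<open>r = t i - 1\<close> factors
      \<open>p i\<close> beside \<open>q\<close>.\<close>
    have "s i - t i + 1 + r = s i" using Suc assms(7)[OF i] by simp
    then have "p i ^ s i = p i ^ (s i - t i + 1) * p i ^ r" by (metis power_add)
    then have "(n - 1) div p i ^ (s i - t i + 1) = p i ^ r * q"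
      using n1 \<open>p i > 0\<close> by (simp add: mult.assoc)
    then obtain b :: int where "[b ^ (p i ^ s i * q) = 1] (mod int n)"
        "[b ^ (p i ^ r * q) \<noteq> 1] (mod int n)"
      using assms(9)[OF i] Suc n1 by auto
    then show ?thesis
      using prime_power_dvd_totient assms(1,3) i \<open>q > 0\<close> Suc by metis
  qed simp
  have "coprime (p i ^ t i) (p j ^ t j)" if "i \<in> {1..k}" "j \<in> {1..k}" "i \<noteq> j" for i j
    using that assms(3,4) by (simp add: inj_on_eq_iff primes_coprime)
  \<comment> \<open>Divisibility is recast as congruence to 0, so that congruences modulo pairwise
    coprime factors combine to one modulo their product.\<close>
  then have "[totient n = 0] (mod m)"
    unfolding assms(6) by (intro coprime_cong_prod_nat) (use dvd in \<open>auto simp: cong_0_iff\<close>)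
  then have "m dvd totient n" by (simp add: cong_0_iff)
  then show ?thesis using assms(8) by blast
qed

end
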